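(* Let $\Bbbk$ be an algebraically closed field and let $f \in \Bbbk[x_1,\ldots,x_n]$ be a nonzero well-poised polynomial. Then the Newton polytope $N(f)$ is a simplex. Further, $N(f)\cap \mathbb{Z}^n$ is precisely the vertex set of $N(f)$.
   Context: Write $f = \sum_i c_i \mathbf{x}^{\mathbf{a}_i}$, a finite sum with nonzero $c_i \in \Bbbk$ and distinct exponent vectors $\mathbf{a}_i \in \mathbb{Z}_{\geq 0}^n$, where $\mathbf{x}^{\mathbf{a}} = x_1^{a_1}\cdots x_n^{a_n}$. For $\boldsymbol\omega \in \mathbb{R}^n$, the initial form $in_{\boldsymbol\omega}(f)$ is the sum of those terms $c_i\mathbf{x}^{\mathbf{a}_i}$ of $f$ for which the inner product $\langle \boldsymbol\omega, \mathbf{a}_i\rangle$ is maximal among all terms of $f$. The polynomial $f$ is well-poised if every initial form $in_{\boldsymbol\omega}(f)$, $\boldsymbol\omega \in \mathbb{R}^n$, which is not a monomial (i.e. which has at least two terms) is irreducible in $\Bbbk[x_1,\ldots,x_n]$. The Newton polytope $N(f) \subset \mathbb{R}^n$ is the convex hull of the set of exponent vectors $\{\mathbf{a}_i : c_i \neq 0\}$. A simplex is the convex hull of a finite affinely independent set (a single point counts as a simplex). *)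

theory Defs
  imports "HOL-Analysis.Analysis" "HOL-Library.Poly_Mapping"
begin

text \<open>
  A polynomial in variables indexed by the finite type \<open>'n\<close> is a finitely supported map from
  exponent vectors to coefficients; \<open>*\<close> on this type is the convolution product, so the type is
  the ring $k[x_1, \ldots, x_n]$ with \<open>n = CARD('n)\<close>. Its \<open>keys\<close> are exactly the exponent vectors
  with nonzero coefficient.
\<close>

type_synonym ('n, 'k) mpoly = "('n \<Rightarrow>\<^sub>0 nat) \<Rightarrow>\<^sub>0 'k"

definition exponent_vec :: "('n::finite \<Rightarrow>\<^sub>0 nat) \<Rightarrow> real ^ 'n" where
  "exponent_vec a = (\<chi> i. real (Poly_Mapping.lookup a i))"

definition initial_form :: "real ^ 'n \<Rightarrow> ('n::finite, 'k::field) mpoly \<Rightarrow> ('n, 'k) mpoly" where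
  "initial_form \<omega> f =
     (\<Sum>a \<in> {a \<in> Poly_Mapping.keys f.
              \<forall>b \<in> Poly_Mapping.keys f. \<omega> \<bullet> exponent_vec b \<le> \<omega> \<bullet> exponent_vec a}.
        Poly_Mapping.single a (Poly_Mapping.lookup f a))"

definition well_poised :: "('n::finite, 'k::field) mpoly \<Rightarrow> bool" where
  "well_poised f \<longleftrightarrow>
     (\<forall>\<omega> :: real ^ 'n. card (Poly_Mapping.keys (initial_form \<omega> f)) \<ge> 2
        \<longrightarrow> irreducible (initial_form \<omega> f))"

definition newton_polytope :: "('n::finite, 'k::field) mpoly \<Rightarrow> (real ^ 'n) set" where
  "newton_polytope f = convex hull (exponent_vec ` Poly_Mapping.keys f)"

end

theory Submission
  imports Defs
begin

text \<open>
  If \<open>in\<^sub>\<omega>(f)\<close> has at least two terms, it is irreducible, so no variable divides it: every face of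
  the Newton polytope of positive dimension contains, for each \<open>i\<close>, an exponent vector with
  \<open>i\<close>-th coordinate zero. Let \<open>v\<close> be a vertex with \<open>v\<^sub>i > 0\<close>, exposed by \<open>\<omega>\<close>, and let some other
  exponent have \<open>i\<close>-th coordinate at least \<open>v\<^sub>i\<close>. Moving \<open>\<omega>\<close> towards \<open>e\<^sub>i\<close> until the first tie gives
  a face that violates this. Hence distinct vertices have disjoint supports, so they are affinely
  independent, and any two of them span an edge.

  If \<open>g\<close> is the gcd of all coordinates of two vertices \<open>v = g \<alpha>\<close> and \<open>w = g \<beta>\<close>, the form on their
  edge is homogeneous of degree \<open>g\<close> in \<open>x\<^sup>\<alpha>\<close> and \<open>x\<^sup>\<beta>\<close>, and over an algebraically closed field it
  splits into linear factors; so \<open>g = 1\<close>. In a lattice point \<open>\<Sum> l\<^sub>v v\<close> of the polytope, the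
  denominator of each \<open>l\<^sub>v\<close> divides the gcd of the coordinates of \<open>v\<close>. These gcds are pairwise
  coprime and the \<open>l\<^sub>v\<close> sum to 1, so all \<open>l\<^sub>v\<close> are integers.
\<close>

section \<open>Weights, units of the polynomial ring, and divisibility by a variable\<close>

text \<open>The ring homomorphism to univariate polynomials sending the monomial \<open>x\<^sup>a\<close> to \<open>t\<^bsup>w a\<^esup>\<close>, for additive \<open>w\<close>.\<close>

definition collapse :: "('a \<Rightarrow> nat) \<Rightarrow> ('a \<Rightarrow>\<^sub>0 'k::comm_semiring_1) \<Rightarrow> 'k poly" where
  "collapse w p = (\<Sum>a\<in>Poly_Mapping.keys p. monom (Poly_Mapping.lookup p a) (w a))"

lemma collapse_single [simp]: "collapse w (Poly_Mapping.single a c) = monom c (w a)"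
  by (simp add: collapse_def)

lemma collapse_add: "collapse w (p + q) = collapse w p + collapse w q"
  unfolding collapse_def by (rule setsum_keys_plus_distrib) (simp_all add: add_monom)

lemma collapse_sum: "collapse w (\<Sum>x\<in>X. h x) = (\<Sum>x\<in>X. collapse w (h x))"
proof (induction X rule: infinite_finite_induct)
  case empty
  show ?case by (simp add: collapse_def)
qed (simp_all add: collapse_add, simp add: collapse_def)

lemma sum_single_lookup:
  "finite X \<Longrightarrow> Poly_Mapping.keys p \<subseteq> X \<Longrightarrow>
    (\<Sum>a\<in>X. Poly_Mapping.single a (Poly_Mapping.lookup p a)) = p"
  by (rule poly_mapping_eqI)
     (auto simp: lookup_sum lookup_single when_def sum.delta in_keys_iff)

lemma collapse_mult:
  fixes p q :: "'a::comm_monoid_add \<Rightarrow>\<^sub>0 'k::comm_semiring_1"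
  assumes "\<And>a b. w (a + b) = w a + w b"
  shows "collapse w (p * q) = collapse w p * collapse w q"
proof -
  have "p * q = (\<Sum>a\<in>Poly_Mapping.keys p. \<Sum>b\<in>Poly_Mapping.keys q.
     Poly_Mapping.single (a + b) (Poly_Mapping.lookup p a * Poly_Mapping.lookup q b))"
    by (subst (1 2) sum_single_lookup[symmetric, OF finite_keys subset_refl])
       (simp add: sum_product mult_single)
  then show ?thesis
    by (simp add: collapse_sum assms flip: mult_monom) (simp add: collapse_def sum_product)
qed

text \<open>With weights \<open>t ^ idx i\<close>, the weights of two distinct exponents differ by
  the value at \<open>t\<close> of a nonzero integer polynomial. Finitely many pairs therefore rule
  out only finitely many \<open>t\<close>.\<close>

lemma ex_inj_weight:
  fixes A :: "('n::finite \<Rightarrow>\<^sub>0 nat) set"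
  assumes "finite A"
  shows "\<exists>w :: 'n \<Rightarrow> nat. inj_on (\<lambda>a. \<Sum>i\<in>UNIV. w i * Poly_Mapping.lookup a i) A"
proof -
  obtain idx :: "'n \<Rightarrow> nat" where idx: "inj idx"
    using finite_imp_inj_to_nat_seg[of "UNIV :: 'n set"] by auto
  define D where "D = (\<lambda>a b :: 'n \<Rightarrow>\<^sub>0 nat.
    \<Sum>i\<in>UNIV. monom (int (Poly_Mapping.lookup a i) - int (Poly_Mapping.lookup b i)) (idx i))"
  have D: "D a b \<noteq> 0" if ab: "a \<noteq> b" for a b
  proof -
    obtain i where i: "Poly_Mapping.lookup a i \<noteq> Poly_Mapping.lookup b i"
      using ab by (metis poly_mapping_eqI)
    have "coeff (D a b) (idx i) = int (Poly_Mapping.lookup a i) - int (Poly_Mapping.lookup b i)"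
      using idx by (simp add: D_def coeff_sum inj_eq sum.delta')
    with i show ?thesis by auto
  qed
  define P where "P = (\<Prod>(a, b)\<in>A \<times> A - Id. D a b)"
  have "P \<noteq> 0"
    using assms D by (auto simp: P_def)
  then have "finite {x. poly P x = 0}"
    by (rule poly_roots_finite)
  then have "finite (int -` {x. poly P x = 0})"
    by (intro finite_vimageI) (auto simp: inj_def)
  then obtain t where t: "poly P (int t) \<noteq> 0"
    using ex_new_if_finite[OF infinite_UNIV_nat, of "int -` {x. poly P x = 0}"] by auto
  have "inj_on (\<lambda>a. \<Sum>i\<in>UNIV. t ^ idx i * Poly_Mapping.lookup a i) A"
  proof (rule inj_onI, rule ccontr)
    fix a b
    assume ab: "a \<in> A" "b \<in> A" "a \<noteq> b" and
      eq: "(\<Sum>i\<in>UNIV. t ^ idx i * Poly_Mapping.lookup a i) = (\<Sum>i\<in>UNIV. t ^ idx i * Poly_Mapping.lookup b i)"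
    have "poly (D a b) (int t) = int (\<Sum>i\<in>UNIV. t ^ idx i * Poly_Mapping.lookup a i)
        - int (\<Sum>i\<in>UNIV. t ^ idx i * Poly_Mapping.lookup b i)"
      by (simp add: D_def poly_sum poly_monom algebra_simps sum_subtractf)
    then have "poly (D a b) (int t) = 0"
      by (simp add: eq)
    with ab assms have "poly P (int t) = 0"
      by (auto simp: P_def poly_prod intro!: prod_zero bexI[of _ "(a, b)"])
    with t show False by simp
  qed
  then show ?thesis by (intro exI)
qed

text \<open>A weight that is injective on the exponents of \<open>p\<close> collapses
  \<open>p\<close> without merging terms, and the units among univariate polynomials over a field
  are constants.\<close>

lemma keys_unit:
  fixes p :: "('n::finite, 'k::field) mpoly"
  assumes "p dvd 1"
  shows "Poly_Mapping.keys p \<subseteq> {0}"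
proof
  fix a assume a: "a \<in> Poly_Mapping.keys p"
  \<comment> \<open>Including \<open>0\<close> ensures that no nonzero exponent of \<open>p\<close>
    has weight zero.\<close>
  obtain w' :: "'n \<Rightarrow> nat" where
    inj: "inj_on (\<lambda>a. \<Sum>i\<in>UNIV. w' i * Poly_Mapping.lookup a i) (insert 0 (Poly_Mapping.keys p))"
    using ex_inj_weight finite_insert finite_keys by metis
  define w where "w = (\<lambda>a. \<Sum>i\<in>UNIV. w' i * Poly_Mapping.lookup a i)"
  have w: "w (a + b) = w a + w b" for a b
    by (simp add: w_def lookup_add algebra_simps sum.distrib)
  obtain q where "1 = p * q"
    using assms by (elim dvdE)
  then have "collapse w p * collapse w q = collapse w 1"
    by (simp add: collapse_mult[symmetric] w)
  also have "\<dots> = 1"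
    by (simp add: w_def flip: single_one)
  finally have "degree (collapse w p) = 0"
    by (metis dvd_triv_left is_unit_iff_degree one_neq_zero mult_zero_left)
  moreover have "coeff (collapse w p) (w a) = Poly_Mapping.lookup p a"
  proof -
    have "coeff (collapse w p) (w a) =
        (\<Sum>b\<in>Poly_Mapping.keys p. if b = a then Poly_Mapping.lookup p b else 0)"
      unfolding collapse_def coeff_sum
      using inj a by (intro sum.cong refl) (auto simp: w_def inj_on_def)
    then show ?thesis using a by simp
  qed
  ultimately have "w a = 0"
    using a by (metis in_keys_iff le_degree le_zero_eq)
  then have "w a = w 0"
    by (simp add: w_def)
  then have "a = 0"
    using inj a by (simp add: w_def inj_on_def)
  then show "a \<in> {0}" by simp
qed

text \<open>The variable of index \<open>i\<close> factors out. It is not a unit, and neither is the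
  cofactor: a unit has at most a constant term, which would leave \<open>p\<close> with at most one
  term.\<close>

lemma not_irreducible_if_var_divides:
  fixes p :: "('n::finite, 'k::field) mpoly"
  assumes "card (Poly_Mapping.keys p) \<ge> 2"
    and "\<And>a. a \<in> Poly_Mapping.keys p \<Longrightarrow> Poly_Mapping.lookup a i > 0"
  shows "\<not> irreducible p"
proof
  assume irr: "irreducible p"
  define e :: "'n \<Rightarrow>\<^sub>0 nat" where "e = Poly_Mapping.single i 1"
  define q where
    "q = (\<Sum>a\<in>Poly_Mapping.keys p. Poly_Mapping.single (a - e) (Poly_Mapping.lookup p a))"
  have e: "e + (a - e) = a" if "a \<in> Poly_Mapping.keys p" for a
    using assms(2)[OF that]
    by (intro poly_mapping_eqI) (auto simp: e_def lookup_add lookup_minus lookup_single when_def)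
  have p: "p = Poly_Mapping.single e 1 * q"
    by (subst sum_single_lookup[symmetric, OF finite_keys subset_refl])
       (simp add: q_def sum_distrib_left mult_single e)
  then have "Poly_Mapping.single e (1::'k) dvd 1 \<or> q dvd 1"
    using irr unfolding irreducible_def by blast
  then show False
  proof
    assume "Poly_Mapping.single e (1::'k) dvd 1"
    then have "e = 0" using keys_unit by fastforce
    then show False by (metis e_def lookup_single_eq lookup_zero zero_neq_one)
  next
    assume "q dvd 1"
    then have "Poly_Mapping.keys q \<subseteq> {0}" by (rule keys_unit)
    then have "Poly_Mapping.keys p \<subseteq> {e}"
      using keys_mult[of "Poly_Mapping.single e 1" q, folded p] by fastforce
    then have "card (Poly_Mapping.keys p) \<le> card {e}"
      by (intro card_mono) simp
    then show False
      using assms(1) by simp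
  qed
qed

section \<open>Binary forms in two monomials\<close>

text \<open>The homogenization \<open>Y\<^sup>d P(X/Y)\<close> at \<open>X = x\<^sup>\<alpha>\<close> and \<open>Y = x\<^sup>\<beta>\<close>, truncating \<open>P\<close> at degree \<open>d\<close>.\<close>

definition binary_form :: "('n \<Rightarrow>\<^sub>0 nat) \<Rightarrow> ('n \<Rightarrow>\<^sub>0 nat) \<Rightarrow> nat \<Rightarrow> 'k poly \<Rightarrow> ('n::finite, 'k::field) mpoly" where
  "binary_form \<alpha> \<beta> d P = (\<Sum>k\<le>d. Poly_Mapping.single
     (Abs_poly_mapping (\<lambda>i. k * Poly_Mapping.lookup \<alpha> i + (d - k) * Poly_Mapping.lookup \<beta> i))
     (coeff P k))"

text \<open>Homogenization is multiplicative, and \<open>[:-r, 1:]\<close> becomes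
  \<open>X - r Y\<close>. The degree bound makes the term \<open>k = Suc d\<close> of the part with
  \<open>r\<close> vanish.\<close>

lemma binary_form_linear_mult:
  assumes "degree Q \<le> d"
  shows "binary_form \<alpha> \<beta> (Suc d) ([:-r, 1:] * Q) =
    (Poly_Mapping.single \<alpha> 1 - Poly_Mapping.single \<beta> r) * binary_form \<alpha> \<beta> d Q"
proof -
  let ?m = "\<lambda>k l. Abs_poly_mapping (\<lambda>i. k * Poly_Mapping.lookup \<alpha> i + l * Poly_Mapping.lookup \<beta> i)"
  have mA: "\<alpha> + ?m k l = ?m (Suc k) l" for k l
    by (intro poly_mapping_eqI) (simp add: lookup_add)
  have mB: "\<beta> + ?m k (d - l) = ?m k (Suc d - l)" if "l \<le> d" for k l
    using that by (intro poly_mapping_eqI) (simp add: lookup_add Suc_diff_le)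
  have "binary_form \<alpha> \<beta> (Suc d) ([:-r, 1:] * Q) =
      (\<Sum>k\<le>Suc d. Poly_Mapping.single (?m k (Suc d - k)) (coeff (pCons 0 Q) k)) -
      (\<Sum>k\<le>Suc d. Poly_Mapping.single (?m k (Suc d - k)) (r * coeff Q k))"
    unfolding binary_form_def sum_subtractf[symmetric] single_diff[symmetric]
    by (intro sum.cong refl) (simp add: algebra_simps)
  also have "(\<Sum>k\<le>Suc d. Poly_Mapping.single (?m k (Suc d - k)) (coeff (pCons 0 Q) k)) =
      Poly_Mapping.single \<alpha> 1 * binary_form \<alpha> \<beta> d Q"
    by (simp add: sum.atMost_Suc_shift binary_form_def sum_distrib_left mult_single mA
        del: sum.atMost_Suc)
  also have "(\<Sum>k\<le>Suc d. Poly_Mapping.single (?m k (Suc d - k)) (r * coeff Q k)) =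
      Poly_Mapping.single \<beta> r * binary_form \<alpha> \<beta> d Q"
    using assms by (simp add: binary_form_def sum_distrib_left mult_single mB coeff_eq_0)
  finally show ?thesis by (simp add: left_diff_distrib)
qed

text \<open>For \<alpha> \<noteq> \<beta> the exponents of the summands are pairwise distinct, so no
  two terms merge.\<close>

lemma lookup_binary_form:
  assumes "\<alpha> \<noteq> \<beta>" "k \<le> d"
  shows "Poly_Mapping.lookup (binary_form \<alpha> \<beta> d P) (Abs_poly_mapping
     (\<lambda>i. k * Poly_Mapping.lookup \<alpha> i + (d - k) * Poly_Mapping.lookup \<beta> i)) = coeff P k"
proof -
  let ?m = "\<lambda>k. Abs_poly_mapping
     (\<lambda>i. k * Poly_Mapping.lookup \<alpha> i + (d - k) * Poly_Mapping.lookup \<beta> i)"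
  obtain i where i: "Poly_Mapping.lookup \<alpha> i \<noteq> Poly_Mapping.lookup \<beta> i"
    using assms by (metis poly_mapping_eqI)
  have "?m l = ?m k \<longleftrightarrow> l = k" if "l \<le> d" for l
  proof
    assume "?m l = ?m k"
    then have "Poly_Mapping.lookup (?m l) i = Poly_Mapping.lookup (?m k) i" by (simp only:)
    \<comment> \<open>Over the integers the difference of the two sides factors, once
      \<open>l \<le> d\<close> and \<open>k \<le> d\<close> turn the truncated subtractions into
      true ones.\<close>
    then have "int l * int (Poly_Mapping.lookup \<alpha> i) + int (d - l) * int (Poly_Mapping.lookup \<beta> i) =
        int k * int (Poly_Mapping.lookup \<alpha> i) + int (d - k) * int (Poly_Mapping.lookup \<beta> i)"
      by (simp flip: of_nat_add of_nat_mult)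
    then have "(int l - int k) * (int (Poly_Mapping.lookup \<alpha> i) - int (Poly_Mapping.lookup \<beta> i)) = 0"
      using that assms(2)
      by (simp add: of_nat_diff algebra_simps)
    with i show "l = k" by simp
  qed simp
  then have "Poly_Mapping.lookup (binary_form \<alpha> \<beta> d P) (?m k) = (\<Sum>l\<le>d. if l = k then coeff P l else 0)"
    unfolding binary_form_def lookup_sum by (intro sum.cong) (auto simp: lookup_single when_def)
  then show ?thesis using assms by simp
qed

text \<open>The outer coefficients put both multiples \<open>d \<alpha>\<close> and
  \<open>d \<beta>\<close> among the exponents. These differ, whereas a unit has no exponent besides
  \<open>0\<close>.\<close>

lemma not_unit_binary_form:
  assumes "\<alpha> \<noteq> \<beta>" "d > 0" "coeff P 0 \<noteq> 0" "coeff P d \<noteq> 0"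
  shows "\<not> binary_form \<alpha> \<beta> d P dvd 1"
proof
  assume "binary_form \<alpha> \<beta> d P dvd 1"
  then have K: "Poly_Mapping.keys (binary_form \<alpha> \<beta> d P) \<subseteq> {0}" by (rule keys_unit)
  have "Abs_poly_mapping (\<lambda>i. d * Poly_Mapping.lookup \<beta> i) = 0"
    using K lookup_binary_form[OF assms(1), of 0 d P] assms(3) by (auto simp: in_keys_iff subset_iff)
  moreover have "Abs_poly_mapping (\<lambda>i. d * Poly_Mapping.lookup \<alpha> i) = 0"
    using K lookup_binary_form[OF assms(1), of d d P] assms(4) by (auto simp: in_keys_iff subset_iff)
  ultimately have "Poly_Mapping.lookup (Abs_poly_mapping (\<lambda>i. d * Poly_Mapping.lookup \<alpha> i)) i =
      Poly_Mapping.lookup (Abs_poly_mapping (\<lambda>i. d * Poly_Mapping.lookup \<beta> i)) i" for i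
    by simp
  then have "d * Poly_Mapping.lookup \<alpha> i = d * Poly_Mapping.lookup \<beta> i" for i
    by simp
  then show False
    using assms(1,2) poly_mapping_eqI[of \<alpha> \<beta>] by simp
qed

text \<open>A root \<open>r\<close> of \<open>P\<close> splits off a linear form. As
  \<open>coeff P 0\<close> is nonzero, so are \<open>r\<close> and the constant coefficient of the
  cofactor; both factors thus keep their two outer terms and are not units.\<close>

lemma not_irreducible_binary_form:
  fixes P :: "'k::alg_closed_field poly"
  assumes "\<alpha> \<noteq> \<beta>" "degree P = d" "d \<ge> 2" "coeff P 0 \<noteq> 0"
  shows "\<not> irreducible (binary_form \<alpha> \<beta> d P)"
proof
  assume irr: "irreducible (binary_form \<alpha> \<beta> d P)"
  obtain r where "poly P r = 0"
    using alg_closed_imp_poly_has_root[of P] assms by auto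
  then obtain Q where P: "P = [:-r, 1:] * Q"
    by (metis dvdE poly_eq_0_iff_dvd)
  obtain e where d: "d = Suc e" and e: "e > 0"
    using assms(3) by (cases d) auto
  have "Q \<noteq> 0" using P assms by auto
  then have degQ: "degree Q = e"
    using assms(2) d by (simp add: P degree_mult_eq del: mult_pCons_left)
  have c0: "r \<noteq> 0" "coeff Q 0 \<noteq> 0"
    using assms(4) by (auto simp: P)
  \<comment> \<open>The linear factor is the product rule for \<open>Q = 1\<close> and
    \<open>d = 0\<close>, so the non-unit criterion covers both factors.\<close>
  have lin: "Poly_Mapping.single \<alpha> 1 - Poly_Mapping.single \<beta> r = binary_form \<alpha> \<beta> 1 [:-r, 1:]"
    using binary_form_linear_mult[of 1 0 \<alpha> \<beta> r] by (simp add: binary_form_def)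
  have "binary_form \<alpha> \<beta> d P = binary_form \<alpha> \<beta> 1 [:-r, 1:] * binary_form \<alpha> \<beta> e Q"
    unfolding P d lin[symmetric] using degQ by (intro binary_form_linear_mult) simp
  then have "binary_form \<alpha> \<beta> 1 [:-r, 1:] dvd 1 \<or> binary_form \<alpha> \<beta> e Q dvd 1"
    using irr unfolding irreducible_def by blast
  then show False
    using not_unit_binary_form[OF assms(1), of 1 "[:-r, 1:]"]
      not_unit_binary_form[OF assms(1) e, of Q] c0 \<open>Q \<noteq> 0\<close> degQ by auto
qed

section \<open>Denominators in convex combinations\<close>

text \<open>By Bezout, the gcd is an integer combination of the elements of
  \<open>D\<close>.\<close>

lemma Ints_mult_Gcd:
  fixes \<mu> :: real
  assumes "finite D" "\<And>d::nat. d \<in> D \<Longrightarrow> \<mu> * real d \<in> \<int>"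
  shows "\<mu> * real (Gcd D) \<in> \<int>"
  using assms
proof (induction D rule: finite_induct)
  case (insert d D)
  obtain u v where uv: "u * int d + v * int (Gcd D) = gcd (int d) (int (Gcd D))"
    using bezout_int by blast
  have "real (gcd d (Gcd D)) = of_int (gcd (int d) (int (Gcd D)))"
    by (metis gcd_int_int_eq of_int_of_nat_eq)
  also have "\<dots> = of_int u * real d + of_int v * real (Gcd D)"
    by (simp only: uv[symmetric] of_int_add of_int_mult of_int_of_nat_eq)
  finally have "\<mu> * real (Gcd (insert d D)) =
      of_int u * (\<mu> * real d) + of_int v * (\<mu> * real (Gcd D))"
    by (simp add: algebra_simps)
  then show ?case
    using insert by auto
qed simp

text \<open>Since \<open>l v\<close> is \<open>1\<close> minus the other coefficients, the product
  \<open>G\<close> of the other \<open>g w\<close> clears its denominator, and so does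
  \<open>g v\<close>. These are coprime, so \<open>l v\<close> is an integer; nonnegative integers
  with sum 1 are a single 1 and zeros.\<close>

lemma convex_combination_coprime_denominators:
  fixes l :: "'a \<Rightarrow> real" and g :: "'a \<Rightarrow> nat"
  assumes "finite V" "\<And>v. v \<in> V \<Longrightarrow> l v \<ge> 0" "(\<Sum>v\<in>V. l v) = 1"
    and int: "\<And>v. v \<in> V \<Longrightarrow> l v * real (g v) \<in> \<int>"
    and cop: "\<And>v w. v \<in> V \<Longrightarrow> w \<in> V \<Longrightarrow> v \<noteq> w \<Longrightarrow> coprime (g v) (g w)"
  obtains v where "v \<in> V" "l v = 1" "\<And>w. w \<in> V \<Longrightarrow> w \<noteq> v \<Longrightarrow> l w = 0"
proof -
  have l_int: "l v \<in> \<int>" if v: "v \<in> V" for v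
  proof -
    define G where "G = (\<Prod>w\<in>V - {v}. g w)"
    have "l w * real G \<in> \<int>" if w: "w \<in> V - {v}" for w
    proof -
      have "g w dvd G"
        using assms(1) w by (auto simp: G_def intro: dvd_prodI)
      then obtain c where "G = g w * c" ..
      then have "l w * real G = (l w * real (g w)) * real c" by simp
      also have "\<dots> \<in> \<int>" by (rule Ints_mult[OF int Ints_of_nat]) (use w in simp)
      finally show ?thesis .
    qed
    then have "real G - (\<Sum>w\<in>V - {v}. l w * real G) \<in> \<int>"
      by (intro Ints_diff Ints_sum) auto
    also have "real G - (\<Sum>w\<in>V - {v}. l w * real G) = l v * real G"
    proof -
      have "l v = 1 - (\<Sum>w\<in>V - {v}. l w)"
        using assms(1,3) v by (simp add: sum.remove)
      then show ?thesis
        by (simp add: left_diff_distrib sum_distrib_right)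
    qed
    finally have "l v * real G \<in> \<int>" .
    then have "l v * real (Gcd {G, g v}) \<in> \<int>"
      using int[OF v] by (intro Ints_mult_Gcd) auto
    moreover have "coprime (g v) G"
      unfolding G_def using cop v by (intro prod_coprime_right) auto
    ultimately show ?thesis
      by (simp add: coprime_commute)
  qed
  obtain v where v: "v \<in> V" "l v \<noteq> 0"
    using assms(3) by (metis sum.neutral zero_neq_one)
  have "l v \<ge> 1"
    using l_int[OF v(1)] assms(2)[OF v(1)] v(2) by (auto elim!: Ints_cases)
  moreover have "l v + (\<Sum>w\<in>V - {v}. l w) = 1"
    using assms(1,3) v(1) by (simp add: sum.remove)
  moreover have "(\<Sum>w\<in>V - {v}. l w) \<ge> 0"
    using assms(2) by (intro sum_nonneg) auto
  ultimately have "l v = 1" "(\<Sum>w\<in>V - {v}. l w) = 0"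
    by linarith+
  moreover from this have "\<forall>w\<in>V - {v}. l w = 0"
    using assms(1,2) by (subst (asm) sum_nonneg_eq_0_iff) auto
  ultimately show ?thesis
    using that v(1) by blast
qed

section \<open>Vectors with disjoint supports\<close>

lemma sum_disjoint_supports_component:
  fixes V :: "(real ^ 'n) set"
  assumes "finite V" "v \<in> V" "v $ i \<noteq> 0"
    and "\<And>v w. v \<in> V \<Longrightarrow> w \<in> V \<Longrightarrow> v \<noteq> w \<Longrightarrow> v $ i = 0 \<or> w $ i = 0"
  shows "(\<Sum>w\<in>V. l w *\<^sub>R w) $ i = l v * v $ i"
proof -
  have "(\<Sum>w\<in>V. l w *\<^sub>R w) $ i = (\<Sum>w\<in>V. if w = v then l v * v $ i else 0)"
    unfolding sum_component using assms by (intro sum.cong) auto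
  with assms(1,2) show ?thesis by simp
qed

text \<open>Reading a relation at a coordinate in the support of \<open>v\<close> kills the
  coefficient of \<open>v\<close>. Only the zero vector may remain, and its coefficient vanishes
  because the coefficients sum to zero.\<close>

lemma affine_independent_disjoint_supports:
  fixes V :: "(real ^ 'n) set"
  assumes "finite V"
    and disj: "\<And>v w i. v \<in> V \<Longrightarrow> w \<in> V \<Longrightarrow> v \<noteq> w \<Longrightarrow> v $ i = 0 \<or> w $ i = 0"
  shows "\<not> affine_dependent V"
proof
  assume "affine_dependent V"
  then obtain U where U: "sum U V = 0" "\<exists>v\<in>V. U v \<noteq> 0" "(\<Sum>v\<in>V. U v *\<^sub>R v) = 0"
    using affine_dependent_explicit_finite[OF assms(1)] by blast
  have nz: "U v = 0" if v: "v \<in> V" "v \<noteq> 0" for v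
  proof -
    obtain i where i: "v $ i \<noteq> 0"
      using v(2) by (auto simp: vec_eq_iff)
    then have "U v * v $ i = 0"
      using sum_disjoint_supports_component[OF assms(1) v(1) i disj, of U] U(3) by simp
    with i show ?thesis by simp
  qed
  have "sum U V = (\<Sum>v\<in>V. if v = 0 then U 0 else 0)"
    using nz by (intro sum.cong) auto
  then have "0 \<in> V \<longrightarrow> U 0 = 0"
    using U(1) assms(1) by (auto split: if_splits)
  with nz U(2) show False by metis
qed

section \<open>Initial forms and vertices of well-poised polynomials\<close>

lemma exponent_vec_nth [simp]: "exponent_vec a $ i = real (Poly_Mapping.lookup a i)"
  by (simp add: exponent_vec_def)

lemma exponent_vec_eq_iff [simp]: "exponent_vec a = exponent_vec b \<longleftrightarrow> a = b"
  by (auto simp: vec_eq_iff intro: poly_mapping_eqI)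

lemma lookup_initial_form:
  "Poly_Mapping.lookup (initial_form \<omega> f) a =
    (if \<forall>b\<in>Poly_Mapping.keys f. \<omega> \<bullet> exponent_vec b \<le> \<omega> \<bullet> exponent_vec a
     then Poly_Mapping.lookup f a else 0)"
  by (auto simp: initial_form_def lookup_sum lookup_single when_def sum.delta in_keys_iff)

lemma keys_initial_form:
  "Poly_Mapping.keys (initial_form \<omega> f) =
    {a \<in> Poly_Mapping.keys f. \<forall>b\<in>Poly_Mapping.keys f. \<omega> \<bullet> exponent_vec b \<le> \<omega> \<bullet> exponent_vec a}"
  by (auto simp: in_keys_iff lookup_initial_form split: if_splits)

lemma well_poised_irreducible:
  assumes "well_poised f" "a \<in> Poly_Mapping.keys f" "b \<in> Poly_Mapping.keys f" "a \<noteq> b"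
    and "\<And>c. c \<in> Poly_Mapping.keys f \<Longrightarrow> \<omega> \<bullet> exponent_vec c \<le> M"
    and "\<omega> \<bullet> exponent_vec a = M" "\<omega> \<bullet> exponent_vec b = M"
  shows "2 \<le> card (Poly_Mapping.keys (initial_form \<omega> f))" "irreducible (initial_form \<omega> f)"
proof -
  have "card {a, b} \<le> card (Poly_Mapping.keys (initial_form \<omega> f))"
    using assms by (intro card_mono) (auto simp: keys_initial_form)
  then show "2 \<le> card (Poly_Mapping.keys (initial_form \<omega> f))"
    using assms(4) by simp
  then show "irreducible (initial_form \<omega> f)"
    using assms(1) by (simp add: well_poised_def)
qed

text \<open>Otherwise the variable of index \<open>i\<close> would divide an irreducible initial
  form with at least two terms.\<close>

lemma well_poised_face_meets_coordinate_hyperplane: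
  assumes "well_poised f" "a \<in> Poly_Mapping.keys f" "b \<in> Poly_Mapping.keys f" "a \<noteq> b"
    and "\<And>c. c \<in> Poly_Mapping.keys f \<Longrightarrow> \<omega> \<bullet> exponent_vec c \<le> M"
    and "\<omega> \<bullet> exponent_vec a = M" "\<omega> \<bullet> exponent_vec b = M"
  obtains c where "c \<in> Poly_Mapping.keys f" "\<omega> \<bullet> exponent_vec c = M" "Poly_Mapping.lookup c i = 0"
proof -
  note irr = well_poised_irreducible[OF assms]
  then obtain c where c: "c \<in> Poly_Mapping.keys (initial_form \<omega> f)" "Poly_Mapping.lookup c i = 0"
    using not_irreducible_if_var_divides by (metis gr0I)
  then have "M \<le> \<omega> \<bullet> exponent_vec c"
    using assms(2,6) by (auto simp: keys_initial_form)
  with c that assms(5) show ?thesis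
    by (auto simp: keys_initial_form intro: antisym)
qed

text \<open>Here \<omega> exposes \<open>v\<close>. When it is tilted towards the direction of
  \<open>i\<close>, only exponents with a larger \<open>i\<close>-th coordinate can catch up with
  \<open>v\<close>, so on the face of the first tie this coordinate never vanishes.\<close>

lemma vertex_unique_max_coordinate:
  fixes f :: "('n::finite, 'k::field) mpoly"
  assumes wp: "well_poised f" and v: "v \<in> Poly_Mapping.keys f" "Poly_Mapping.lookup v i > 0"
    and \<omega>: "\<And>a. a \<in> Poly_Mapping.keys f \<Longrightarrow> a \<noteq> v \<Longrightarrow> \<omega> \<bullet> exponent_vec a < \<omega> \<bullet> exponent_vec v"
    and b: "b \<in> Poly_Mapping.keys f" "b \<noteq> v"
  shows "Poly_Mapping.lookup b i < Poly_Mapping.lookup v i"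
proof (rule ccontr)
  assume "\<not> ?thesis"
  then have bv: "Poly_Mapping.lookup v i \<le> Poly_Mapping.lookup b i" by simp
  let ?x = "\<lambda>a. real (Poly_Mapping.lookup a i)"
  have ax: "axis i 1 \<bullet> exponent_vec a = ?x a" for a :: "'n \<Rightarrow>\<^sub>0 nat"
    by (simp add: inner_axis')
  define U where "U = {a \<in> Poly_Mapping.keys f. Poly_Mapping.lookup a i > Poly_Mapping.lookup v i}"
  show False
  proof (cases "U = {}")
    case True
    then have le: "Poly_Mapping.lookup a i \<le> Poly_Mapping.lookup v i"
      if "a \<in> Poly_Mapping.keys f" for a
      using that by (force simp: U_def)
    \<comment> \<open>No tilt produces a tie here, but \<open>b\<close> agrees with \<open>v\<close>
      in coordinate \<open>i\<close>. The direction of \<open>i\<close> alone then attains its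
      maximum at both, on a face where this coordinate is positive.\<close>
    obtain c where "axis i 1 \<bullet> exponent_vec c = ?x v" "Poly_Mapping.lookup c i = 0"
      by (rule well_poised_face_meets_coordinate_hyperplane
            [OF wp b(1) v(1) b(2), of "axis i 1" "?x v" i])
         (use le bv b in \<open>auto simp: ax intro: antisym\<close>)
    with v(2) show False by (simp add: ax)
  next
    case False
    \<comment> \<open>\<open>h a\<close> is the value of \<open>s\<close> at which \<open>a\<close>
      ties with \<open>v\<close> under \<open>\<omega> + s *\<^sub>R axis i 1\<close>; its minimum
      over \<open>U\<close> is the first tie.\<close>
    define h where "h a = (\<omega> \<bullet> exponent_vec v - \<omega> \<bullet> exponent_vec a) / (?x a - ?x v)" for a
    have "finite U" by (simp add: U_def)
    then obtain u where u: "u \<in> U" and min: "\<And>a. a \<in> U \<Longrightarrow> h u \<le> h a"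
      using False by (metis arg_min_if_finite(1) arg_min_least)
    have uv: "u \<noteq> v" "u \<in> Poly_Mapping.keys f" "?x u > ?x v"
      using u by (auto simp: U_def)
    have s: "h u > 0"
      using \<omega>[OF uv(2,1)] uv(3) by (simp add: h_def)
    define \<omega>' where "\<omega>' = \<omega> + h u *\<^sub>R axis i 1"
    define M where "M = \<omega>' \<bullet> exponent_vec v"
    have \<omega>': "\<omega>' \<bullet> exponent_vec a = \<omega> \<bullet> exponent_vec a + h u * ?x a" for a
      by (simp add: \<omega>'_def inner_add_left ax)
    \<comment> \<open>Outside \<open>U\<close> the tilt favours \<open>a\<close> no more than
      \<open>v\<close>, so the strict inequality for \<omega> persists.\<close>
    have less: "\<omega>' \<bullet> exponent_vec a < M"
      if "a \<in> Poly_Mapping.keys f" "a \<noteq> v" "a \<notin> U" for a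
    proof -
      have "h u * ?x a \<le> h u * ?x v"
        using that s by (intro mult_left_mono) (auto simp: U_def)
      with \<omega>[OF that(1,2)] show ?thesis by (simp add: M_def \<omega>')
    qed
    have "\<omega>' \<bullet> exponent_vec a \<le> M" if "a \<in> U" for a
    proof -
      have "?x a - ?x v > 0" using that by (simp add: U_def)
      then have "h u * (?x a - ?x v) \<le> \<omega> \<bullet> exponent_vec v - \<omega> \<bullet> exponent_vec a"
        using min[OF that] by (simp add: h_def[of a] pos_le_divide_eq)
      then show ?thesis by (simp add: M_def \<omega>' algebra_simps)
    qed
    with less have le: "\<omega>' \<bullet> exponent_vec a \<le> M" if "a \<in> Poly_Mapping.keys f" for a
      using that by (metis M_def less_imp_le order_refl)
    have "h u * (?x u - ?x v) = \<omega> \<bullet> exponent_vec v - \<omega> \<bullet> exponent_vec u"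
      using uv(3) by (simp add: h_def)
    then have eq: "\<omega>' \<bullet> exponent_vec u = M"
      by (simp add: M_def \<omega>' algebra_simps)
    \<comment> \<open>With coordinate \<open>0\<close>, \<open>c\<close> is neither \<open>v\<close>
      nor in \<open>U\<close>, so \<open>less\<close> keeps it off the face.\<close>
    obtain c where "c \<in> Poly_Mapping.keys f" "\<omega>' \<bullet> exponent_vec c = M" "Poly_Mapping.lookup c i = 0"
      using well_poised_face_meets_coordinate_hyperplane[OF wp uv(2) v(1) uv(1) le eq M_def[symmetric]]
      by metis
    with less[of c] v(2) show False by (force simp: U_def)
  qed
qed

section \<open>Edges and common divisors of their endpoints\<close>

text \<open>If the gcd \<open>g\<close> of all coordinates of \<open>a\<close> and \<open>b\<close>
  were at least 2, the lattice points of the edge would be the \<open>g + 1\<close> evenly spaced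
  points \<open>m k\<close>. The initial form would then be a binary form of degree
  \<open>g\<close>, hence reducible.\<close>

lemma well_poised_edge_coprime:
  fixes f :: "('n::finite, 'k::alg_closed_field) mpoly"
  assumes wp: "well_poised f" and a: "a \<in> Poly_Mapping.keys f" and b: "b \<in> Poly_Mapping.keys f"
    and "a \<noteq> b"
    and disj: "\<And>i. Poly_Mapping.lookup a i = 0 \<or> Poly_Mapping.lookup b i = 0"
    and le: "\<And>c. c \<in> Poly_Mapping.keys f \<Longrightarrow> \<omega> \<bullet> exponent_vec c \<le> M"
    and a_M: "\<omega> \<bullet> exponent_vec a = M" and b_M: "\<omega> \<bullet> exponent_vec b = M"
    and edge: "\<And>c. c \<in> Poly_Mapping.keys f \<Longrightarrow> \<omega> \<bullet> exponent_vec c = M \<Longrightarrow>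
      exponent_vec c \<in> closed_segment (exponent_vec a) (exponent_vec b)"
  shows "coprime (Gcd (range (Poly_Mapping.lookup a))) (Gcd (range (Poly_Mapping.lookup b)))"
proof (rule ccontr)
  define D where "D = range (Poly_Mapping.lookup a) \<union> range (Poly_Mapping.lookup b)"
  define g where "g = Gcd D"
  assume not_coprime: "\<not> ?thesis"
  have "c dvd g" if "c dvd Gcd (range (Poly_Mapping.lookup a))"
    "c dvd Gcd (range (Poly_Mapping.lookup b))" for c
    using that by (auto simp: g_def D_def dvd_Gcd_iff)
  with not_coprime have "g \<noteq> 1"
    by (metis coprimeI)
  moreover have "g \<noteq> 0"
  proof
    assume "g = 0"
    then have "D \<subseteq> {0}" by (simp add: g_def)
    then have "Poly_Mapping.lookup a i = Poly_Mapping.lookup b i" for i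
      by (auto simp: D_def image_subset_iff)
    with \<open>a \<noteq> b\<close> show False by (metis poly_mapping_eqI)
  qed
  ultimately have g: "g \<ge> 2" by simp
  define \<alpha> \<beta> :: "'n \<Rightarrow>\<^sub>0 nat"
    where "\<alpha> = Abs_poly_mapping (\<lambda>i. Poly_Mapping.lookup a i div g)"
      and "\<beta> = Abs_poly_mapping (\<lambda>i. Poly_Mapping.lookup b i div g)"
  have a_i: "Poly_Mapping.lookup a i = g * Poly_Mapping.lookup \<alpha> i" for i
    by (auto simp: \<alpha>_def g_def D_def)
  have b_i: "Poly_Mapping.lookup b i = g * Poly_Mapping.lookup \<beta> i" for i
    by (auto simp: \<beta>_def g_def D_def)
  have \<alpha>\<beta>: "\<alpha> \<noteq> \<beta>"
    using \<open>a \<noteq> b\<close> a_i b_i by (metis poly_mapping_eqI)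
  define m where "m k = Abs_poly_mapping
    (\<lambda>i. k * Poly_Mapping.lookup \<alpha> i + (g - k) * Poly_Mapping.lookup \<beta> i)" for k
  have m_ends: "m g = a" "m 0 = b"
    by (rule poly_mapping_eqI, simp add: m_def a_i b_i)+
  \<comment> \<open>The outer coefficients of \<open>P\<close> are those of \<open>f\<close> at
    \<open>b\<close> and \<open>a\<close>, hence nonzero; this gives degree \<open>g\<close> and a
    nonzero constant term.\<close>
  define P where "P = (\<Sum>k\<le>g. monom (Poly_Mapping.lookup f (m k)) k)"
  have coeff_P: "coeff P k = (if k \<le> g then Poly_Mapping.lookup f (m k) else 0)" for k
    by (simp add: P_def coeff_sum sum.delta)
  have "degree P = g"
  proof (rule antisym)
    show "degree P \<le> g" by (rule degree_le) (simp add: coeff_P)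
    show "g \<le> degree P" using a by (intro le_degree) (simp add: coeff_P m_ends in_keys_iff)
  qed
  have m_M: "\<omega> \<bullet> exponent_vec (m k) = M" if "k \<le> g" for k
  proof -
    have "real g *\<^sub>R exponent_vec (m k) = real k *\<^sub>R exponent_vec a + real (g - k) *\<^sub>R exponent_vec b"
      by (simp add: vec_eq_iff m_def a_i b_i distrib_left ac_simps)
    then have "\<omega> \<bullet> (real g *\<^sub>R exponent_vec (m k)) =
        \<omega> \<bullet> (real k *\<^sub>R exponent_vec a + real (g - k) *\<^sub>R exponent_vec b)" by simp
    then have "real g * (\<omega> \<bullet> exponent_vec (m k)) = real k * M + real (g - k) * M"
      by (simp only: inner_add_right inner_scaleR_right a_M b_M)
    also have "\<dots> = real g * M"
      using that by (simp add: of_nat_diff algebra_simps)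
    finally show ?thesis using g by simp
  qed
  have on_edge: "\<exists>k\<le>g. c = m k"
    if c: "c \<in> Poly_Mapping.keys f" "\<omega> \<bullet> exponent_vec c = M" for c
  proof -
    obtain u where u: "0 \<le> u" "u \<le> 1"
      and ev: "exponent_vec c = (1 - u) *\<^sub>R exponent_vec b + u *\<^sub>R exponent_vec a"
      using edge[OF c] by (subst (asm) closed_segment_commute) (auto simp: in_segment)
    have c_i: "real (Poly_Mapping.lookup c i) =
        (1 - u) * real (Poly_Mapping.lookup b i) + u * real (Poly_Mapping.lookup a i)" for i
      using arg_cong[OF ev, of "\<lambda>x. x $ i"] by simp
    \<comment> \<open>As supports are disjoint, a coordinate of \<open>c\<close> is \<open>u\<close>
      times that of \<open>a\<close> or \<open>1 - u\<close> times that of \<open>b\<close>. Hence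
      \<open>u\<close> times any coordinate of either endpoint is an integer.\<close>
    have "u * real d \<in> \<int>" if d: "d \<in> D" for d
    proof -
      consider i where "d = Poly_Mapping.lookup a i" | i where "d = Poly_Mapping.lookup b i"
        using d by (auto simp: D_def)
      then show ?thesis
      proof cases
        case (1 i)
        show ?thesis
        proof (cases "Poly_Mapping.lookup b i = 0")
          case True
          then have "u * real d = real (Poly_Mapping.lookup c i)" using c_i[of i] 1 by simp
          then show ?thesis by simp
        next
          case False
          then show ?thesis using disj[of i] 1 by simp
        qed
      next
        case (2 i)
        show ?thesis
        proof (cases "Poly_Mapping.lookup a i = 0")
          case True
          then have "u * real d = real d - real (Poly_Mapping.lookup c i)"
            using c_i[of i] 2 by (simp add: algebra_simps)
          then show ?thesis by simp
        next
          case False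
          then show ?thesis using disj[of i] 2 by simp
        qed
      qed
    qed
    then have "u * real g \<in> \<int>"
      unfolding g_def by (intro Ints_mult_Gcd) (simp_all add: D_def)
    moreover have "u * real g \<ge> 0" using u by simp
    ultimately obtain k where k: "u * real g = real k"
      by (metis Ints_cases of_int_0_le_iff of_int_of_nat_eq zero_le_imp_eq_int)
    have "k \<le> g"
      using u g k mult_right_mono[of u 1 "real g"] by simp
    have "real (Poly_Mapping.lookup c i) = real (Poly_Mapping.lookup (m k) i)" for i
    proof -
      have "real (Poly_Mapping.lookup c i) = (real g - u * real g) * real (Poly_Mapping.lookup \<beta> i)
          + (u * real g) * real (Poly_Mapping.lookup \<alpha> i)"
        by (simp add: c_i a_i b_i algebra_simps)
      then show ?thesis
        using \<open>k \<le> g\<close> by (simp add: k m_def of_nat_diff)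
    qed
    then have "c = m k" by (intro poly_mapping_eqI) simp
    with \<open>k \<le> g\<close> show ?thesis by blast
  qed
  have "initial_form \<omega> f = binary_form \<alpha> \<beta> g P"
  proof (rule poly_mapping_eqI)
    fix c
    show "Poly_Mapping.lookup (initial_form \<omega> f) c = Poly_Mapping.lookup (binary_form \<alpha> \<beta> g P) c"
    proof (cases "\<exists>k\<le>g. c = m k")
      case True
      then obtain k where k: "k \<le> g" "c = m k" by blast
      then have "Poly_Mapping.lookup (binary_form \<alpha> \<beta> g P) c = Poly_Mapping.lookup f c"
        using lookup_binary_form[OF \<alpha>\<beta> k(1), of P] by (simp add: coeff_P m_def[symmetric])
      then show ?thesis
        using le m_M k by (simp add: lookup_initial_form)
    next
      case False
      then have "Poly_Mapping.lookup (binary_form \<alpha> \<beta> g P) c = 0"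
        by (auto simp: binary_form_def lookup_sum lookup_single when_def m_def intro!: sum.neutral)
      moreover have "c \<notin> Poly_Mapping.keys (initial_form \<omega> f)"
        using False on_edge le a a_M by (force simp: keys_initial_form)
      ultimately show ?thesis by (simp add: in_keys_iff)
    qed
  qed
  moreover have "\<not> irreducible (binary_form \<alpha> \<beta> g P)"
    using b \<open>degree P = g\<close> g
    by (intro not_irreducible_binary_form \<alpha>\<beta>) (auto simp: coeff_P m_ends in_keys_iff)
  ultimately show False
    using well_poised_irreducible(2)[OF wp a b \<open>a \<noteq> b\<close> le a_M b_M] by simp
qed

section \<open>Faces, the simplex and its lattice points\<close>

text \<open>Faces of a polyhedron are exposed. Restricting the supporting functional to the exponent
  vectors yields the form in which initial forms see a face.\<close>

lemma face_newton_polytope_supporting: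
  assumes "F face_of newton_polytope f"
  obtains \<omega> M where "\<And>a. a \<in> Poly_Mapping.keys f \<Longrightarrow> \<omega> \<bullet> exponent_vec a \<le> M"
    "\<And>a. a \<in> Poly_Mapping.keys f \<Longrightarrow> \<omega> \<bullet> exponent_vec a = M \<longleftrightarrow> exponent_vec a \<in> F"
proof -
  have "polyhedron (newton_polytope f)"
    by (simp add: newton_polytope_def polytope_convex_hull polytope_imp_polyhedron)
  then have "F exposed_face_of newton_polytope f"
    using assms exposed_face_of_polyhedron by blast
  then obtain \<omega> M where "newton_polytope f \<subseteq> {x. \<omega> \<bullet> x \<le> M}"
    "F = newton_polytope f \<inter> {x. \<omega> \<bullet> x = M}"
    unfolding exposed_face_of_def by blast
  moreover have "exponent_vec a \<in> newton_polytope f" if "a \<in> Poly_Mapping.keys f" for a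
    using that by (simp add: newton_polytope_def hull_inc)
  ultimately show ?thesis
    by (intro that[of \<omega> M]) auto
qed

theorem theorem1p2:
  fixes f :: "('n::finite, 'k::alg_closed_field) mpoly"
  assumes "f \<noteq> 0"
    and "well_poised f"
  shows "(\<exists>d::nat. int d simplex newton_polytope f) \<and>
         newton_polytope f \<inter> {x. \<forall>i. x $ i \<in> \<int>} = {v. v extreme_point_of newton_polytope f}"
proof -
  let ?N = "newton_polytope f"
  define V where "V = {v. v extreme_point_of ?N}"
  have V_sub: "V \<subseteq> exponent_vec ` Poly_Mapping.keys f"
    using extreme_points_of_convex_hull by (auto simp: V_def newton_polytope_def)
  then have fin: "finite V"
    by (rule finite_subset) simp
  have hull: "?N = convex hull V"
    unfolding V_def newton_polytope_def by (rule Krein_Milman_polytope) simp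
  have "V \<noteq> {}"
    using assms(1) hull by (auto simp: newton_polytope_def)
  have max: "Poly_Mapping.lookup b i < Poly_Mapping.lookup a i"
    if "a \<in> Poly_Mapping.keys f" "exponent_vec a \<in> V" "b \<in> Poly_Mapping.keys f" "b \<noteq> a"
      "Poly_Mapping.lookup a i > 0" for a b i
  proof -
    have "{exponent_vec a} face_of ?N"
      using that(2) by (simp add: V_def face_of_singleton)
    then obtain \<omega> M where
      \<omega>: "\<And>c. c \<in> Poly_Mapping.keys f \<Longrightarrow> \<omega> \<bullet> exponent_vec c \<le> M"
        "\<And>c. c \<in> Poly_Mapping.keys f \<Longrightarrow> \<omega> \<bullet> exponent_vec c = M \<longleftrightarrow> exponent_vec c \<in> {exponent_vec a}"
      by (rule face_newton_polytope_supporting) blast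
    have "\<omega> \<bullet> exponent_vec c < \<omega> \<bullet> exponent_vec a"
      if "c \<in> Poly_Mapping.keys f" "c \<noteq> a" for c
      using \<omega>(1)[OF that(1)] \<omega>(2)[OF that(1)] \<omega>(2)[OF \<open>a \<in> Poly_Mapping.keys f\<close>] that(2)
      by force
    from vertex_unique_max_coordinate[OF assms(2) that(1,5) this that(3,4)] show ?thesis .
  qed
  \<comment> \<open>If both vertices were positive at \<open>i\<close>, each would have a strictly
    smaller \<open>i\<close>-th coordinate than the other.\<close>
  have disj: "v $ i = 0 \<or> w $ i = 0" if vw: "v \<in> V" "w \<in> V" "v \<noteq> w" for v w i
  proof (rule ccontr)
    assume nz: "\<not> ?thesis"
    obtain a b where ab: "a \<in> Poly_Mapping.keys f" "b \<in> Poly_Mapping.keys f"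
      "v = exponent_vec a" "w = exponent_vec b"
      using vw V_sub by blast
    then show False
      using max[of a b i] max[of b a i] vw nz by auto
  qed
  have indep: "\<not> affine_dependent V"
    by (rule affine_independent_disjoint_supports[OF fin disj])
  have "card V > 0"
    using fin \<open>V \<noteq> {}\<close> by (simp add: card_gt_0_iff)
  then have "int (card V - 1) simplex ?N"
    unfolding simplex_def using indep hull by (intro exI[of _ V]) simp
  then have "\<exists>d::nat. int d simplex ?N" ..
  moreover have "x \<in> V" if x: "x \<in> ?N" "\<And>i. x $ i \<in> \<int>" for x
  proof -
    \<comment> \<open>The floor lets the gcd of the coordinates be a function of real vectors, as
      needed for a sum indexed by \<open>V\<close>; it changes nothing at exponent vectors.\<close>
    define content where "content v = Gcd (range (\<lambda>i. nat \<lfloor>v $ i\<rfloor>))" for v :: "real ^ 'n"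
    have content: "content (exponent_vec a) = Gcd (range (Poly_Mapping.lookup a))"
      for a :: "'n \<Rightarrow>\<^sub>0 nat"
      by (simp add: content_def)
    obtain l where l: "\<And>v. v \<in> V \<Longrightarrow> 0 \<le> l v" "sum l V = 1" "(\<Sum>v\<in>V. l v *\<^sub>R v) = x"
      using x(1) unfolding hull convex_hull_finite[OF fin] by blast
    \<comment> \<open>Only \<open>v\<close> contributes at a coordinate in its support, so there
      \<open>l v * v $ i\<close> is a coordinate of the lattice point \<open>x\<close>.\<close>
    have int: "l v * real (content v) \<in> \<int>" if v: "v \<in> V" for v
      unfolding content_def
    proof (rule Ints_mult_Gcd)
      fix d assume "d \<in> range (\<lambda>i. nat \<lfloor>v $ i\<rfloor>)"
      then obtain i where "d = nat \<lfloor>v $ i\<rfloor>" by blast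
      moreover obtain a where "v = exponent_vec a" using v V_sub by blast
      ultimately have d: "real d = v $ i" by simp
      show "l v * real d \<in> \<int>"
      proof (cases "v $ i = 0")
        case False
        have "l v * v $ i = x $ i"
          using sum_disjoint_supports_component[OF fin v False disj, of l] l(3) by simp
        with x(2)[of i] d show ?thesis by simp
      qed (simp add: d)
    qed simp
    have cop: "coprime (content v) (content w)" if vw: "v \<in> V" "w \<in> V" "v \<noteq> w" for v w
    proof -
      obtain a b where ab: "a \<in> Poly_Mapping.keys f" "b \<in> Poly_Mapping.keys f"
        "v = exponent_vec a" "w = exponent_vec b"
        using vw V_sub by blast
      \<comment> \<open>Every subset of the vertices of a simplex spans a face, so any two vertices
        are joined by an edge.\<close>
      have "convex hull {v, w} face_of ?N"
        unfolding hull face_of_convex_hull_affine_independent[OF indep] using vw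
        by (intro exI[of _ "{v, w}"]) simp
      then have "closed_segment v w face_of ?N"
        by (simp add: segment_convex_hull)
      then obtain \<omega> M where
        \<omega>: "\<And>c. c \<in> Poly_Mapping.keys f \<Longrightarrow> \<omega> \<bullet> exponent_vec c \<le> M"
          "\<And>c. c \<in> Poly_Mapping.keys f \<Longrightarrow>
            \<omega> \<bullet> exponent_vec c = M \<longleftrightarrow> exponent_vec c \<in> closed_segment v w"
        by (rule face_newton_polytope_supporting) blast
      have "coprime (Gcd (range (Poly_Mapping.lookup a))) (Gcd (range (Poly_Mapping.lookup b)))"
      proof (rule well_poised_edge_coprime[OF assms(2) ab(1,2) _ _ \<omega>(1)])
        show "Poly_Mapping.lookup a i = 0 \<or> Poly_Mapping.lookup b i = 0" for i
          using disj[OF vw, of i] ab by simp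
      qed (use ab vw \<omega>(2) in auto)
      then show ?thesis by (simp add: ab content)
    qed
    obtain v where v: "v \<in> V" "l v = 1" "\<And>w. w \<in> V \<Longrightarrow> w \<noteq> v \<Longrightarrow> l w = 0"
      by (rule convex_combination_coprime_denominators[OF fin, of l content])
        (use l int cop in blast)+
    have "x = (\<Sum>w\<in>V. if w = v then v else 0)"
      unfolding l(3)[symmetric] using v by (intro sum.cong) auto
    with v(1) fin show ?thesis by simp
  qed
  moreover have "v \<in> ?N" "\<And>i. v $ i \<in> \<int>" if "v \<in> V" for v
    using that V_sub hull hull_inc[of v V] by auto
  ultimately show ?thesis
    unfolding V_def by blast
qed

end
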